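(* Let $\boldsymbol X=(X_1,\dots,X_d)=A\times_{\max}\boldsymbol Z$ be a recursive max-linear (ML) vector on a well-ordered DAG satisfying assumptions (A1)-(A3) of the context. For nonempty $\boldsymbol h\subseteq\{1,\dots,d\}$ let $M_{\boldsymbol h}=\max_{i\in\boldsymbol h}X_i$, with squared scaling $\sigma^2_{M_{\boldsymbol h}}$, and write $\sigma_i^2=\sigma_{X_i}^2$ (so $\sigma^2_{M_{d}}=\sigma_d^2$). Then the following recursion yields the standardized ML coefficient matrix $A=(a_{ij})$: $$a_{dd}^2=\sigma_d^2=1,\qquad a_{ii}^2=\sigma^2_{M_{i,\dots,d}}-\sigma^2_{M_{i+1,\dots,d}},\quad i=1,\dots,d-1,$$ $$a_{ij}^2=\sigma^2_{M_{i,j+1,j+2,\dots,d}}-\sigma^2_{M_{j+1,j+2,\dots,d}}-\sum_{k=i}^{j-1}a_{ik}^2,\quad i=1,\dots,d-2,\ j=i+1,\dots,d-1,$$ $$a_{id}^2=\sigma_i^2-\sum_{k=i}^{d-1}a_{ik}^2=1-\sum_{k=i}^{d-1}a_{ik}^2,\quad i=1,\dots,d-1.$$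
   Context: Recursive ML vector. Let $\mathcal D=(V,E)$ be a DAG with nodes $V=\{1,\dots,d\}$; $\mathrm{pa}(i)$ are the parents of $i$, $\mathrm{an}(i)$ the ancestors of $i$ (not including $i$), $\mathrm{An}(i)=\mathrm{an}(i)\cup\{i\}$. $\mathcal D$ is well-ordered if $i<j$ for all $i\in V$ and $j\in\mathrm{pa}(i)$ (so $A$ below is upper triangular). An innovations vector $\boldsymbol Z=(Z_1,\dots,Z_d)$ has independent, atom-free components with support $\mathbb R_+$. Given edge weights $c_{ik}>0$ for $k\in\mathrm{pa}(i)\cup\{i\}$, define $X_i=\bigvee_{k\in\mathrm{pa}(i)}c_{ik}X_k\vee c_{ii}Z_i$. For a path $p=[j\to k_1\to\cdots\to k_l=i]$ put $d(p)=c_{jj}c_{k_1j}\cdots c_{ik_{l-1}}$; let $a_{ij}=\max_p d(p)$ over all paths from $j$ to $i$ if $j\in\mathrm{an}(i)$, $a_{ii}=c_{ii}$, and $a_{ij}=0$ if $j\notin\mathrm{An}(i)$. Then $X_i=\bigvee_{j=1}^d a_{ij}Z_j$, written $\boldsymbol X=A\times_{\max}\boldsymbol Z$; $\boldsymbol X$ is called a recursive ML vector and $A=(a_{ij})$ its ML coefficient matrix. Regular variation. $\boldsymbol Y\in\mathbb R^d_+$ is in $RV^d_+(2)$ (with normalizing sequence $b_n=\sqrt n$ and the Euclidean norm) if, for $R=\|\boldsymbol Y\|_2$ and $\boldsymbol\omega=\boldsymbol Y/R$, $n\mathbb P[(R/\sqrt n,\boldsymbol\omega)\in\cdot]\to\nu_2\times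 H_{\boldsymbol Y}$ vaguely on $(0,\infty]\times\Theta_+^{d-1}$, where $d\nu_2(x)=2x^{-3}dx$, $\Theta_+^{d-1}=\{\boldsymbol\omega\in\mathbb R_+^d:\|\boldsymbol\omega\|_2=1\}$ and $H_{\boldsymbol Y}$ is a finite (spectral) measure. Scalings. For $Y\in RV^1_+(2)$ the squared scaling is $\sigma_Y^2=\lim_{n\to\infty}n\mathbb P(Y>\sqrt n)$. Assumptions. (A1) $\boldsymbol Z\in RV^d_+(2)$ has independent and standardized components: $n\mathbb P(n^{-1/2}Z_i>x)\to x^{-2}$ for all $x>0$ and all $i$. (A2) The norm is the Euclidean norm. (A3) $A$ is standardized, i.e. $a_{ij}$ is replaced by $a_{ij}/(\sum_{k=1}^da_{ik}^2)^{1/2}$, so that $\sum_{k=1}^d a_{ik}^2=1$ for every $i$. *)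

theory Defs
  imports "HOL-Probability.Probability"
begin

text \<open>A DAG on the nodes \<open>1, \<dots>, d\<close> is given by its set \<open>E\<close> of edges; \<open>(j, i) \<in> E\<close> stands
  for the edge \<open>j \<rightarrow> i\<close>.\<close>

definition parents :: "(nat \<times> nat) set \<Rightarrow> nat \<Rightarrow> nat set" where
  "parents E i = {j. (j, i) \<in> E}"

definition ancestors :: "(nat \<times> nat) set \<Rightarrow> nat \<Rightarrow> nat set" where
  "ancestors E i = {j. (j, i) \<in> E\<^sup>+}"

definition well_ordered_dag :: "nat \<Rightarrow> (nat \<times> nat) set \<Rightarrow> bool" where
  "well_ordered_dag d E \<longleftrightarrow>
     E \<subseteq> {1..d} \<times> {1..d} \<and> acyclic E \<and> (\<forall>i\<in>{1..d}. \<forall>j\<in>parents E i. i < j)"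

text \<open>Weights are indexed as \<open>c i k\<close> with \<open>i\<close> the head of the edge \<open>k \<rightarrow> i\<close>.\<close>

definition edge_weights :: "nat \<Rightarrow> (nat \<times> nat) set \<Rightarrow> (nat \<Rightarrow> nat \<Rightarrow> real) \<Rightarrow> bool" where
  "edge_weights d E c \<longleftrightarrow> (\<forall>i\<in>{1..d}. \<forall>k\<in>parents E i \<union> {i}. c i k > 0)"

definition paths :: "(nat \<times> nat) set \<Rightarrow> nat \<Rightarrow> nat \<Rightarrow> nat list set" where
  "paths E j i =
     {p. p \<noteq> [] \<and> hd p = j \<and> last p = i \<and> successively (\<lambda>u v. (u, v) \<in> E) p}"

fun edge_product :: "(nat \<Rightarrow> nat \<Rightarrow> real) \<Rightarrow> nat list \<Rightarrow> real" where
  "edge_product c (u # v # p) = c v u * edge_product c (v # p)"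
| "edge_product c _ = 1"

definition path_weight :: "(nat \<Rightarrow> nat \<Rightarrow> real) \<Rightarrow> nat list \<Rightarrow> real" where
  "path_weight c p = c (hd p) (hd p) * edge_product c p"

definition ml_coeff :: "(nat \<times> nat) set \<Rightarrow> (nat \<Rightarrow> nat \<Rightarrow> real) \<Rightarrow> nat \<Rightarrow> nat \<Rightarrow> real" where
  "ml_coeff E c i j =
     (if j \<in> ancestors E i then Max (path_weight c ` paths E j i)
      else if j = i then c i i
      else 0)"

definition row_norm :: "nat \<Rightarrow> (nat \<Rightarrow> nat \<Rightarrow> real) \<Rightarrow> nat \<Rightarrow> real" where
  "row_norm d A i = sqrt (\<Sum>k=1..d. (A i k)\<^sup>2)"

definition standardized_matrix :: "nat \<Rightarrow> (nat \<Rightarrow> nat \<Rightarrow> real) \<Rightarrow> bool" where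
  "standardized_matrix d A \<longleftrightarrow> (\<forall>i\<in>{1..d}. (\<Sum>k=1..d. (A i k)\<^sup>2) = 1)"

definition recursive_ML ::
  "'a measure \<Rightarrow> nat \<Rightarrow> (nat \<times> nat) set \<Rightarrow> (nat \<Rightarrow> nat \<Rightarrow> real) \<Rightarrow>
   (nat \<Rightarrow> 'a \<Rightarrow> real) \<Rightarrow> (nat \<Rightarrow> 'a \<Rightarrow> real) \<Rightarrow> bool" where
  "recursive_ML M d E c Z X \<longleftrightarrow>
     (\<forall>i\<in>{1..d}. \<forall>\<omega>\<in>space M.
        X i \<omega> = Max (insert (c i i * Z i \<omega>) ((\<lambda>k. c i k * X k \<omega>) ` parents E i)))"

definition measure_support :: "'b::topological_space measure \<Rightarrow> 'b set" where
  "measure_support N = {x. \<forall>U. open U \<and> x \<in> U \<longrightarrow> emeasure N U > 0}"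

definition innovations :: "'a measure \<Rightarrow> nat \<Rightarrow> (nat \<Rightarrow> 'a \<Rightarrow> real) \<Rightarrow> bool" where
  "innovations M d Z \<longleftrightarrow>
     prob_space.indep_vars M (\<lambda>_. borel) Z {1..d} \<and>
     (\<forall>i\<in>{1..d}. (\<forall>x. measure (distr M borel (Z i)) {x} = 0) \<and>
                  measure_support (distr M borel (Z i)) = {0..})"

definition max_over :: "(nat \<Rightarrow> 'a \<Rightarrow> real) \<Rightarrow> nat set \<Rightarrow> 'a \<Rightarrow> real" where
  "max_over X h \<omega> = Max ((\<lambda>i. X i \<omega>) ` h)"

text \<open>Vague convergence of the restrictions to \<open>S\<close>, tested on the nonnegative continuous
  functions on \<open>S\<close> with compact support in \<open>S\<close>.\<close>

definition vague_conv_on ::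
  "'b::topological_space set \<Rightarrow> (nat \<Rightarrow> 'b measure) \<Rightarrow> 'b measure \<Rightarrow> bool" where
  "vague_conv_on S \<mu> \<nu> \<longleftrightarrow>
     (\<forall>f :: 'b \<Rightarrow> real.
        continuous_on S f \<and> (\<forall>x\<in>S. f x \<ge> 0) \<and>
        (\<exists>K. compact K \<and> K \<subseteq> S \<and> (\<forall>x\<in>S - K. f x = 0))
        \<longrightarrow> (\<lambda>n. LINT x:S|\<mu> n. f x) \<longlonglongrightarrow> (LINT x:S|\<nu>. f x))"

text \<open>Vectors in \<open>\<real>\<^sup>d\<close> are functions on \<open>nat\<close> vanishing outside \<open>{1..d}\<close>; on these the
  topology of \<open>nat \<Rightarrow> real\<close> is the Euclidean one.\<close>

definition pos_sphere :: "nat \<Rightarrow> (nat \<Rightarrow> real) set" where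
  "pos_sphere d =
     {w. (\<forall>i. i \<notin> {1..d} \<longrightarrow> w i = 0) \<and> (\<forall>i\<in>{1..d}. w i \<ge> 0) \<and> L2_set w {1..d} = 1}"

definition radial :: "nat \<Rightarrow> (nat \<Rightarrow> 'a \<Rightarrow> real) \<Rightarrow> 'a \<Rightarrow> real" where
  "radial d Y \<omega> = L2_set (\<lambda>i. Y i \<omega>) {1..d}"

definition angular :: "nat \<Rightarrow> (nat \<Rightarrow> 'a \<Rightarrow> real) \<Rightarrow> 'a \<Rightarrow> nat \<Rightarrow> real" where
  "angular d Y \<omega> = (\<lambda>i. if i \<in> {1..d} then Y i \<omega> / radial d Y \<omega> else 0)"

text \<open>The measure \<open>2 x\<^sup>-\<^sup>3 dx\<close> on \<open>(0, \<infinity>]\<close>, without mass at \<open>\<infinity>\<close>.\<close>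

definition nu2 :: "ereal measure" where
  "nu2 = distr (density lborel (\<lambda>x::real. ennreal (indicator {0<..} x * (2 / x ^ 3)))) borel ereal"

definition RV_plus2 :: "'a measure \<Rightarrow> nat \<Rightarrow> (nat \<Rightarrow> 'a \<Rightarrow> real) \<Rightarrow> bool" where
  "RV_plus2 M d Y \<longleftrightarrow>
     (\<forall>i\<in>{1..d}. Y i \<in> borel_measurable M \<and> (AE \<omega> in M. Y i \<omega> \<ge> 0)) \<and>
     (\<exists>H :: (nat \<Rightarrow> real) measure.
        sets H = sets borel \<and> finite_measure H \<and> emeasure H (- pos_sphere d) = 0 \<and>
        vague_conv_on ({0<..} \<times> pos_sphere d)
          (\<lambda>n. scale_measure (of_nat n)
                 (distr M borel (\<lambda>\<omega>. (ereal (radial d Y \<omega> / sqrt (real n)), angular d Y \<omega>))))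
          (nu2 \<Otimes>\<^sub>M H))"

definition standardized_margins :: "'a measure \<Rightarrow> nat \<Rightarrow> (nat \<Rightarrow> 'a \<Rightarrow> real) \<Rightarrow> bool" where
  "standardized_margins M d Z \<longleftrightarrow>
     (\<forall>i\<in>{1..d}. \<forall>x>0.
        (\<lambda>n. real n * measure M {\<omega>\<in>space M. Z i \<omega> / sqrt (real n) > x}) \<longlonglongrightarrow> 1 / x\<^sup>2)"

definition scaling_seq :: "'a measure \<Rightarrow> ('a \<Rightarrow> real) \<Rightarrow> nat \<Rightarrow> real" where
  "scaling_seq M Y n = real n * measure M {\<omega>\<in>space M. Y \<omega> > sqrt (real n)}"

definition squared_scaling :: "'a measure \<Rightarrow> ('a \<Rightarrow> real) \<Rightarrow> real" where
  "squared_scaling M Y = lim (scaling_seq M Y)"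

text \<open>Every ML coefficient matrix can be standardized by changing the edge weights: dividing each
  row of the coefficient matrix by its norm, and each component of the vector by the same number,
  gives the recursive max-linear vector (on the same DAG, with the same innovations) of the
  weights \<open>rescale_weights s c\<close>, where \<open>s\<close> is the vector of the row norms.\<close>

definition rescale_weights ::
  "(nat \<Rightarrow> real) \<Rightarrow> (nat \<Rightarrow> nat \<Rightarrow> real) \<Rightarrow> nat \<Rightarrow> nat \<Rightarrow> real" where
  "rescale_weights s c i k = (if k = i then c i i / s i else c i k * s k / s i)"

lemma successively_imp_sorted:
  assumes "well_ordered_dag d E" "successively (\<lambda>u v. (u, v) \<in> E) p"
  shows "sorted_wrt (>) p"
proof -
  have "successively (>) p"
    using assms by (auto elim!: successively_mono simp: well_ordered_dag_def parents_def)
  thus ?thesis by (subst (asm) successively_conv_sorted_wrt) (auto simp: transp_def)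
qed

lemma paths_subset:
  assumes "well_ordered_dag d E" "i \<in> {1..d}" "p \<in> paths E j i"
  shows "set p \<subseteq> {1..d}"
proof -
  have E: "E \<subseteq> {1..d} \<times> {1..d}" using assms(1) by (simp add: well_ordered_dag_def)
  have "p \<noteq> [] \<Longrightarrow> successively (\<lambda>u v. (u, v) \<in> E) p \<Longrightarrow> last p \<in> {1..d} \<Longrightarrow> set p \<subseteq> {1..d}"
    using E by (induction p rule: induct_list012) auto
  thus ?thesis using assms by (auto simp: paths_def)
qed

lemma finite_paths:
  assumes "well_ordered_dag d E" "i \<in> {1..d}"
  shows "finite (paths E j i)"
proof (rule finite_subset)
  show "paths E j i \<subseteq> {p. set p \<subseteq> {1..d} \<and> length p \<le> d}"
  proof
    fix p assume p: "p \<in> paths E j i"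
    have "sorted_wrt (>) p"
      using p successively_imp_sorted[OF assms(1)] by (auto simp: paths_def)
    hence "distinct p" by (induction p) auto
    hence "length p = card (set p)" by (simp add: distinct_card)
    also have "\<dots> \<le> d" using card_mono[OF _ paths_subset[OF assms p]] by simp
    finally show "p \<in> {p. set p \<subseteq> {1..d} \<and> length p \<le> d}"
      using paths_subset[OF assms p] by auto
  qed
qed (simp add: finite_lists_length_le)

lemma paths_nonempty:
  assumes "j \<in> ancestors E i"
  shows "paths E j i \<noteq> {}"
proof -
  have "(j, i) \<in> E\<^sup>+" using assms by (simp add: ancestors_def)
  hence "\<exists>p. p \<in> paths E j i"
  proof (induction rule: trancl_induct)
    case (base y)
    have "[j, y] \<in> paths E j y" using base by (simp add: paths_def)
    thus ?case ..
  next
    case (step y z)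
    then obtain p where "p \<in> paths E j y" by blast
    hence "p @ [z] \<in> paths E j z"
      using step.hyps by (auto simp: paths_def successively_append_iff)
    thus ?case ..
  qed
  thus ?thesis by blast
qed

lemma row_norm_ml_coeff_pos:
  assumes "well_ordered_dag d E" "edge_weights d E c" "i \<in> {1..d}"
  shows "row_norm d (ml_coeff E c) i > 0"
proof -
  have "i \<notin> ancestors E i"
    using assms(1) by (auto simp: ancestors_def well_ordered_dag_def acyclic_def)
  moreover have "c i i > 0" using assms(2,3) by (simp add: edge_weights_def)
  ultimately have "(ml_coeff E c i i)\<^sup>2 > 0" by (simp add: ml_coeff_def)
  also have "(ml_coeff E c i i)\<^sup>2 \<le> (\<Sum>k=1..d. (ml_coeff E c i k)\<^sup>2)"
    using assms(3) by (intro member_le_sum) auto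
  finally show ?thesis by (simp add: row_norm_def)
qed

lemma path_weight_rescale:
  assumes "well_ordered_dag d E" "i \<in> {1..d}" "p \<in> paths E j i" "\<And>k. k \<in> {1..d} \<Longrightarrow> s k > 0"
  shows "path_weight (rescale_weights s c) p = path_weight c p / s i"
proof -
  have ne: "u \<noteq> v" if "(u, v) \<in> E" for u v
    using that assms(1) by (auto simp: well_ordered_dag_def acyclic_def)
  have *: "p \<noteq> [] \<Longrightarrow> successively (\<lambda>u v. (u, v) \<in> E) p \<Longrightarrow> \<forall>k\<in>set p. s k \<noteq> 0 \<Longrightarrow>
        edge_product (rescale_weights s c) p = edge_product c p * s (hd p) / s (last p)" for p
  proof (induction p rule: induct_list012)
    case (3 x y zs)
    thus ?case using ne[of x y] by (auto simp: rescale_weights_def)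
  qed auto
  have nz: "\<forall>k\<in>set p. s k \<noteq> 0"
    using paths_subset[OF assms(1-3)] assms(4) by fastforce
  have "s (hd p) \<noteq> 0" using nz assms(3) by (auto simp: paths_def)
  with * [of p] nz assms(3) show ?thesis
    by (auto simp: path_weight_def paths_def rescale_weights_def)
qed

lemma edge_weights_rescale:
  assumes "well_ordered_dag d E" "edge_weights d E c" "\<And>k. k \<in> {1..d} \<Longrightarrow> s k > 0"
  shows "edge_weights d E (rescale_weights s c)"
proof -
  have "k \<in> {1..d}" if "k \<in> parents E i" for i k
    using that assms(1) by (auto simp: well_ordered_dag_def parents_def)
  thus ?thesis
    using assms(2,3) by (auto simp: edge_weights_def rescale_weights_def)
qed

lemma ml_coeff_rescale:
  assumes "well_ordered_dag d E" "i \<in> {1..d}" "\<And>k. k \<in> {1..d} \<Longrightarrow> s k > 0"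
  shows "ml_coeff E (rescale_weights s c) i j = ml_coeff E c i j / s i"
proof (cases "j \<in> ancestors E i")
  case True
  have "mono (\<lambda>x. x / s i)"
    using assms(2,3) by (intro monoI divide_right_mono) (auto intro: less_imp_le)
  hence "Max (path_weight c ` paths E j i) / s i =
      Max ((\<lambda>x. x / s i) ` path_weight c ` paths E j i)"
    by (rule mono_Max_commute) (use finite_paths[OF assms(1,2)] paths_nonempty[OF True] in auto)
  also have "(\<lambda>x. x / s i) ` path_weight c ` paths E j i =
      path_weight (rescale_weights s c) ` paths E j i"
    unfolding image_image using path_weight_rescale[OF assms(1,2) _ assms(3)]
    by (intro image_cong) auto
  finally show ?thesis using True by (simp add: ml_coeff_def)
next
  case False
  thus ?thesis by (auto simp: ml_coeff_def rescale_weights_def)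
qed

lemma standardized_ml_coeff_rescale:
  assumes "well_ordered_dag d E" "edge_weights d E c"
  defines "s \<equiv> row_norm d (ml_coeff E c)"
  shows "standardized_matrix d (ml_coeff E (rescale_weights s c))"
  unfolding standardized_matrix_def
proof
  fix i assume i: "i \<in> {1..d}"
  have pos: "s k > 0" if "k \<in> {1..d}" for k
    unfolding s_def by (rule row_norm_ml_coeff_pos[OF assms(1,2) that])
  have "(\<Sum>k=1..d. (ml_coeff E (rescale_weights s c) i k)\<^sup>2) =
      (\<Sum>k=1..d. (ml_coeff E c i k)\<^sup>2) / (s i)\<^sup>2"
    using ml_coeff_rescale[OF assms(1) i pos] by (simp add: power_divide sum_divide_distrib)
  also have "(\<Sum>k=1..d. (ml_coeff E c i k)\<^sup>2) = (s i)\<^sup>2"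
    by (simp add: s_def row_norm_def sum_nonneg)
  finally show "(\<Sum>k=1..d. (ml_coeff E (rescale_weights s c) i k)\<^sup>2) = 1"
    using pos[OF i] by simp
qed

lemma recursive_ML_rescale:
  assumes "well_ordered_dag d E" "\<And>k. k \<in> {1..d} \<Longrightarrow> s k > 0" "recursive_ML M d E c Z X"
  shows "recursive_ML M d E (rescale_weights s c) Z (\<lambda>i \<omega>. X i \<omega> / s i)"
  unfolding recursive_ML_def
proof (intro ballI)
  fix i \<omega> assume i: "i \<in> {1..d}" and \<omega>: "\<omega> \<in> space M"
  have par: "k \<in> {1..d} \<and> k \<noteq> i" if "k \<in> parents E i" for k
    using that assms(1) by (auto simp: well_ordered_dag_def parents_def)
  hence fin: "finite (parents E i)" by (meson finite_atLeastAtMost finite_subset subsetI)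
  have "mono (\<lambda>x. x / s i)"
    using assms(2) i by (intro monoI divide_right_mono) (auto intro: less_imp_le)
  hence "X i \<omega> / s i = Max ((\<lambda>x. x / s i) `
      insert (c i i * Z i \<omega>) ((\<lambda>k. c i k * X k \<omega>) ` parents E i))"
    using assms(3) i \<omega> fin by (subst mono_Max_commute[symmetric]) (auto simp: recursive_ML_def)
  also have "(\<lambda>x. x / s i) ` insert (c i i * Z i \<omega>) ((\<lambda>k. c i k * X k \<omega>) ` parents E i) =
      insert (rescale_weights s c i i * Z i \<omega>)
        ((\<lambda>k. rescale_weights s c i k * (X k \<omega> / s k)) ` parents E i)"
    unfolding image_insert image_image
    using par assms(2) by (intro arg_cong2[of _ _ _ _ insert] image_cong)
      (force simp: rescale_weights_def)+
  finally show "X i \<omega> / s i = Max (insert (rescale_weights s c i i * Z i \<omega>)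
      ((\<lambda>k. rescale_weights s c i k * (X k \<omega> / s k)) ` parents E i))" .
qed

end

theory Submission
  imports Defs
begin

text \<open>Since \<open>X\<^sub>i\<close> exceeds \<open>t \<ge> 0\<close> iff some \<open>a\<^sub>i\<^sub>j Z\<^sub>j\<close> does, \<open>M\<^sub>h\<close> exceeds \<open>t\<close> iff some
  \<open>b\<^sub>j Z\<^sub>j\<close> does, where \<open>b\<^sub>j\<close> is the maximum of column \<open>j\<close> over the rows in \<open>h\<close>; by independence
  the squared scaling of \<open>M\<^sub>h\<close> is \<open>\<Sum>\<^sub>j b\<^sub>j\<^sup>2\<close>. Concatenating paths gives
  \<open>a\<^sub>i\<^sub>j a\<^sub>j\<^sub>k \<le> a\<^sub>j\<^sub>j a\<^sub>i\<^sub>k\<close>, and squaring and summing over \<open>k\<close> turns this, for standardized rows,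
  into \<open>a\<^sub>i\<^sub>j \<le> a\<^sub>j\<^sub>j\<close>. So for \<open>h = {i, j + 1, \<dots>, d}\<close> the column maxima are the diagonal entries
  in the columns beyond \<open>j\<close> and, by triangularity, the entries of row \<open>i\<close> in the others.\<close>

section \<open>Max-linear coefficients\<close>

lemma edge_product_concat:
  "edge_product c (p @ u # q) = edge_product c (p @ [u]) * edge_product c (u # q)"
  by (induction p rule: induct_list012) auto

text \<open>\<open>tl\<close> removes the second copy of the shared node \<open>j\<close>. The only
  node factor of the joined path is \<open>c k k\<close> at the start of \<open>q\<close>, so
  \<open>p\<close> contributes its edges alone.\<close>

lemma paths_concat:
  assumes "q \<in> paths E k j" "p \<in> paths E j i"
  shows "q @ tl p \<in> paths E k i"
    and "path_weight c (q @ tl p) = path_weight c q * edge_product c p"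
proof -
  obtain p' where p: "p = j # p'"
    using assms(2) by (cases p) (auto simp: paths_def)
  obtain q' where q: "q = q' @ [j]"
    using assms(1) by (cases q rule: rev_cases) (auto simp: paths_def)
  show "q @ tl p \<in> paths E k i"
    using assms unfolding p q
    by (cases p') (auto simp: paths_def successively_append_iff hd_append split: if_splits)
  show "path_weight c (q @ tl p) = path_weight c q * edge_product c p"
    unfolding p q path_weight_def using edge_product_concat[of c q' j p']
    by (simp add: hd_append)
qed

section \<open>Coefficients as maximal path weights, and dominance of the diagonal\<close>

locale weighted_dag =
  fixes d :: nat and E :: "(nat \<times> nat) set" and c :: "nat \<Rightarrow> nat \<Rightarrow> real"
  assumes dag: "well_ordered_dag d E" and weights: "edge_weights d E c"
begin

abbreviation A :: "nat \<Rightarrow> nat \<Rightarrow> real" where "A \<equiv> ml_coeff E c"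

lemma parents_bounds: "k \<in> parents E i \<Longrightarrow> i \<in> {1..d} \<and> k \<in> {1..d} \<and> i < k"
  using dag by (auto simp: well_ordered_dag_def parents_def)

lemma finite_parents: "finite (parents E i)"
  by (rule finite_subset[of _ "{1..d}"]) (auto dest: parents_bounds)

lemma weight_pos: "i \<in> {1..d} \<Longrightarrow> k \<in> parents E i \<union> {i} \<Longrightarrow> c i k > 0"
  using weights by (auto simp: edge_weights_def)

lemma ancestors_gt: "j \<in> ancestors E i \<Longrightarrow> i < j"
  unfolding ancestors_def mem_Collect_eq
  by (induction rule: trancl_induct) (use parents_bounds in \<open>fastforce simp: parents_def\<close>)+

text \<open>\<open>paths\<close> admits the one-node list, of weight \<open>c i i\<close>. Isolating
  it lets the three cases of \<open>ml_coeff\<close> be treated as one: a maximum of path weights,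
  or 0 when there is no path.\<close>

lemma paths_imp_ancestor:
  assumes "p \<in> paths E j i"
  shows "p = [i] \<and> j = i \<or> j \<in> ancestors E i"
proof -
  have "p \<noteq> [] \<Longrightarrow> successively (\<lambda>u v. (u, v) \<in> E) p \<Longrightarrow>
      (\<exists>u. p = [u]) \<or> (hd p, last p) \<in> E\<^sup>+"
  proof (induction p rule: induct_list012)
    case (3 x y zs)
    thus ?case by (auto intro: trancl_into_trancl2)
  qed auto
  thus ?thesis using assms by (auto simp: paths_def ancestors_def)
qed

lemma ml_coeff_ge:
  assumes "i \<in> {1..d}" "p \<in> paths E j i"
  shows "path_weight c p \<le> A i j"
proof (cases "j \<in> ancestors E i")
  case True
  thus ?thesis using assms finite_paths[OF dag assms(1)] by (simp add: ml_coeff_def)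
next
  case False
  with paths_imp_ancestor[OF assms(2)] have "p = [i]" "j = i" by auto
  thus ?thesis using False by (simp add: ml_coeff_def path_weight_def)
qed

lemma ml_coeff_attained:
  assumes "i \<in> {1..d}" "A i j \<noteq> 0"
  obtains p where "p \<in> paths E j i" "A i j = path_weight c p"
proof (cases "j \<in> ancestors E i")
  case True
  hence "A i j \<in> path_weight c ` paths E j i"
    using finite_paths[OF dag assms(1)] paths_nonempty[OF True]
    by (auto simp: ml_coeff_def intro!: Max_in)
  thus ?thesis using that by blast
next
  case False
  hence "j = i" using assms(2) by (auto simp: ml_coeff_def split: if_splits)
  thus ?thesis using False that[of "[i]"] by (simp add: ml_coeff_def paths_def path_weight_def)
qed

lemma edge_product_pos:
  assumes "i \<in> {1..d}" "p \<in> paths E j i"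
  shows "edge_product c p > 0"
proof -
  have "successively (\<lambda>u v. (u, v) \<in> E) p \<Longrightarrow> edge_product c p > 0" for p
  proof (induction p rule: induct_list012)
    case (3 x y zs)
    hence "x \<in> parents E y" by (simp add: parents_def)
    hence "c y x > 0" using weight_pos[of y x] parents_bounds[of x y] by simp
    thus ?case using 3 by simp
  qed auto
  thus ?thesis using assms(2) by (simp add: paths_def)
qed

lemma path_weight_pos:
  assumes "i \<in> {1..d}" "p \<in> paths E j i"
  shows "path_weight c p > 0"
proof -
  have "j \<in> {1..d}"
    using subsetD[OF paths_subset[OF dag assms], of "hd p"] assms(2) hd_in_set[of p]
    by (auto simp: paths_def)
  thus ?thesis
    using edge_product_pos[OF assms] weight_pos[of j j] assms(2)
    by (auto simp: path_weight_def paths_def)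
qed

lemma ml_coeff_nonneg: "i \<in> {1..d} \<Longrightarrow> A i j \<ge> 0"
  by (metis ml_coeff_attained path_weight_pos less_imp_le order_refl)

lemma ml_coeff_diag: "A i i = c i i"
  using ancestors_gt[of i i] by (auto simp: ml_coeff_def)

lemma ml_coeff_upper: "j < i \<Longrightarrow> A i j = 0"
  using ancestors_gt[of j i] by (auto simp: ml_coeff_def)

text \<open>When optimal paths from \<open>k\<close> to \<open>j\<close> and from \<open>j\<close>
  to \<open>i\<close> are joined, the starting factor \<open>c j j\<close> of the second one is
  lost; \<open>A j j\<close> on the right compensates for it. The joined path need not be optimal,
  hence only an inequality.\<close>

lemma ml_coeff_mult_le:
  assumes "i \<in> {1..d}" "j \<in> {1..d}"
  shows "A i j * A j k \<le> A j j * A i k"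
proof (cases "A i j = 0 \<or> A j k = 0")
  case True
  thus ?thesis using ml_coeff_nonneg assms by auto
next
  case False
  then obtain p q where p: "p \<in> paths E j i" "A i j = path_weight c p"
    and q: "q \<in> paths E k j" "A j k = path_weight c q"
    using ml_coeff_attained assms by metis
  have "A i j * A j k = c j j * path_weight c (q @ tl p)"
    using p q by (simp add: paths_concat(2)[OF q(1) p(1)]) (simp add: path_weight_def paths_def)
  also have "\<dots> \<le> c j j * A i k"
    using ml_coeff_ge[OF assms(1) paths_concat(1)[OF q(1) p(1)]] weight_pos[of j j] assms(2)
    by (intro mult_left_mono) auto
  finally show ?thesis by (simp add: ml_coeff_diag)
qed

lemma ml_coeff_le_diag:
  assumes "standardized_matrix d A" "i \<in> {1..d}" "j \<in> {1..d}"
  shows "A i j \<le> A j j"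
proof (rule power2_le_imp_le)
  \<comment> \<open>Row \<open>j\<close> has unit norm, so multiplying by its squared entries and
    summing changes nothing; the last step uses the unit norm of row \<open>i\<close> in the same
    way.\<close>
  have "(A i j)\<^sup>2 = (\<Sum>k=1..d. (A i j * A j k)\<^sup>2)"
    using assms by (simp add: standardized_matrix_def power_mult_distrib flip: sum_distrib_left)
  also have "\<dots> \<le> (\<Sum>k=1..d. (A j j * A i k)\<^sup>2)"
    using ml_coeff_mult_le ml_coeff_nonneg assms(2,3) by (intro sum_mono power_mono) auto
  also have "\<dots> = (A j j)\<^sup>2"
    using assms by (simp add: standardized_matrix_def power_mult_distrib flip: sum_distrib_left)
  finally show "(A i j)\<^sup>2 \<le> (A j j)\<^sup>2" .
qed (use ml_coeff_nonneg assms in auto)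

section \<open>From the recursion over parents to the max-linear representation\<close>

lemma ml_coeff_parent_le:
  assumes "k \<in> parents E i"
  shows "c i k * A k j \<le> A i j"
proof (cases "A k j = 0")
  case True
  thus ?thesis using parents_bounds[OF assms] ml_coeff_nonneg by simp
next
  case False
  have ik: "i \<in> {1..d}" "k \<in> {1..d}" using parents_bounds[OF assms] by auto
  obtain q where q: "q \<in> paths E j k" "A k j = path_weight c q"
    using ml_coeff_attained[OF ik(2) False] .
  have edge: "[k, i] \<in> paths E k i" using assms by (simp add: paths_def parents_def)
  show ?thesis
    using paths_concat(2)[OF q(1) edge, of c] ml_coeff_ge[OF ik(1) paths_concat(1)[OF q(1) edge]] q(2)
    by (simp add: mult.commute)
qed

text \<open>Cutting the last edge off an optimal path leaves a path to a parent \<open>k\<close>.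
  Its weight is at most \<open>A k j\<close>, and \<open>ml_coeff_parent_le\<close> turns the
  resulting bound into an equality.\<close>

lemma ml_coeff_parent_attained:
  assumes "i \<in> {1..d}" "A i j \<noteq> 0" "j \<noteq> i"
  obtains k where "k \<in> parents E i" "A i j = c i k * A k j"
proof -
  obtain p where p: "p \<in> paths E j i" "A i j = path_weight c p"
    using ml_coeff_attained[OF assms(1,2)] .
  then obtain q where q: "p = q @ [i]"
    by (cases p rule: rev_cases) (auto simp: paths_def)
  have "q \<noteq> []" using p(1) assms(3) by (auto simp: paths_def q)
  hence k: "last q \<in> parents E i" and "q \<in> paths E j (last q)"
    using p(1) by (auto simp: paths_def q parents_def successively_append_iff)
  have "[last q, i] \<in> paths E (last q) i" using k by (simp add: paths_def parents_def)
  from paths_concat(2)[OF \<open>q \<in> paths E j (last q)\<close> this, of c]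
  have "A i j = path_weight c q * c i (last q)" using p(2) q by simp
  also have "\<dots> \<le> A (last q) j * c i (last q)"
    using ml_coeff_ge[OF _ \<open>q \<in> paths E j (last q)\<close>] parents_bounds[OF k] weight_pos[of i "last q"] k
    by (intro mult_right_mono) auto
  finally have "A i j \<le> c i (last q) * A (last q) j" by (simp add: mult.commute)
  with ml_coeff_parent_le[OF k, of j] that[OF k] show thesis by simp
qed

text \<open>The restriction to \<open>t \<ge> 0\<close> makes the sign of \<open>Z\<close> irrelevant: a term that exceeds \<open>t\<close> is
  positive, so increasing its coefficient increases it.\<close>

lemma recursive_ML_gt_iff:
  assumes "recursive_ML M d E c Z X" "\<omega> \<in> space M" "i \<in> {1..d}" "t \<ge> 0"
  shows "X i \<omega> > t \<longleftrightarrow> (\<exists>j\<in>{1..d}. A i j * Z j \<omega> > t)"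
  using assms(3,4)
\<comment> \<open>Parents have larger labels, so \<open>d - i\<close> decreases from a node to its
  parents. The threshold must vary, because passing to the parent \<open>k\<close> divides it by
  \<open>c i k\<close>.\<close>
proof (induction "d - i" arbitrary: i t rule: less_induct)
  case less
  note i = less.prems(1) and t = less.prems(2)
  have IH: "c i k * X k \<omega> > t \<longleftrightarrow> (\<exists>j\<in>{1..d}. c i k * A k j * Z j \<omega> > t)"
    if k: "k \<in> parents E i" for k
  proof -
    have pos: "c i k > 0" using weight_pos[OF i] k by simp
    have "X k \<omega> > t / c i k \<longleftrightarrow> (\<exists>j\<in>{1..d}. A k j * Z j \<omega> > t / c i k)"
      using parents_bounds[OF k] t pos by (intro less.hyps) auto
    thus ?thesis using pos by (simp add: pos_divide_less_eq mult_ac)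
  qed
  have mono: "b * z > t" if "a * z > t" "0 \<le> a" "a \<le> b" for a b z
  proof -
    have "z > 0" using that t by (smt (verit) mult_nonneg_nonpos)
    hence "a * z \<le> b * z" using that(3) by (intro mult_right_mono) auto
    thus ?thesis using that(1) by simp
  qed
  have "X i \<omega> > t \<longleftrightarrow> c i i * Z i \<omega> > t \<or> (\<exists>k\<in>parents E i. c i k * X k \<omega> > t)"
    using assms(1,2) i finite_parents by (simp add: recursive_ML_def Max_gr_iff)
  also have "\<dots> \<longleftrightarrow> (\<exists>j\<in>{1..d}. A i j * Z j \<omega> > t)"
  proof
    assume "c i i * Z i \<omega> > t \<or> (\<exists>k\<in>parents E i. c i k * X k \<omega> > t)"
    then consider "A i i * Z i \<omega> > t"
      | k j where "k \<in> parents E i" "j \<in> {1..d}" "c i k * A k j * Z j \<omega> > t"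
      using IH by (auto simp: ml_coeff_diag)
    thus "\<exists>j\<in>{1..d}. A i j * Z j \<omega> > t"
    proof cases
      case 1
      thus ?thesis using i by blast
    next
      case (2 k j)
      have "0 \<le> c i k * A k j"
        using 2(1) weight_pos[OF i, of k] ml_coeff_nonneg parents_bounds[OF 2(1)] by simp
      from mono[OF 2(3) this ml_coeff_parent_le[OF 2(1)]] 2(2) show ?thesis by blast
    qed
  next
    assume "\<exists>j\<in>{1..d}. A i j * Z j \<omega> > t"
    then obtain j where j: "j \<in> {1..d}" "A i j * Z j \<omega> > t" by blast
    show "c i i * Z i \<omega> > t \<or> (\<exists>k\<in>parents E i. c i k * X k \<omega> > t)"
    proof (cases "j = i")
      case True
      thus ?thesis using j by (simp add: ml_coeff_diag)
    next
      case False
      have "A i j \<noteq> 0" using j t by auto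
      then obtain k where "k \<in> parents E i" "A i j = c i k * A k j"
        using ml_coeff_parent_attained[OF i] False by blast
      thus ?thesis using IH j by auto
    qed
  qed
  finally show ?case .
qed

section \<open>Column maxima and exceedances of maxima over rows\<close>

definition col_max :: "nat set \<Rightarrow> nat \<Rightarrow> real" where
  "col_max h j = Max ((\<lambda>i. A i j) ` h)"

lemma col_max_nonneg:
  assumes "h \<noteq> {}" "h \<subseteq> {1..d}"
  shows "col_max h j \<ge> 0"
proof -
  have "finite h" using assms(2) finite_subset by blast
  moreover obtain i where "i \<in> h" "A i j \<ge> 0" using assms ml_coeff_nonneg by blast
  ultimately show ?thesis
    unfolding col_max_def by (intro order_trans[OF _ Max_ge[of _ "A i j"]]) auto
qed

lemma col_max_diag:
  assumes "standardized_matrix d A" "h \<subseteq> {1..d}" "j \<in> h"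
  shows "col_max h j = A j j"
  unfolding col_max_def
  using assms ml_coeff_le_diag[OF assms(1)] finite_subset[OF assms(2)]
  by (intro Max_eqI) blast+

text \<open>Exceeding \<open>t\<close> turns maxima into existential quantifiers, so those over rows
  and over columns can be swapped; \<open>col\<close> then turns the quantifier over rows back into
  a maximum.\<close>

lemma max_over_gt_iff:
  assumes "recursive_ML M d E c Z X" "\<omega> \<in> space M" "h \<noteq> {}" "h \<subseteq> {1..d}" "t \<ge> 0"
  shows "max_over X h \<omega> > t \<longleftrightarrow> (\<exists>j\<in>{1..d}. col_max h j * Z j \<omega> > t)"
proof -
  have fin: "finite h" using assms(4) finite_subset by blast
  have col: "(\<exists>i\<in>h. A i j * z > t) \<longleftrightarrow> col_max h j * z > t" for j z
  proof
    assume "\<exists>i\<in>h. A i j * z > t"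
    then obtain i where i: "i \<in> h" "A i j * z > t" by blast
    have "A i j \<ge> 0" using ml_coeff_nonneg i(1) assms(4) by auto
    hence "z > 0" using i(2) assms(5) by (smt (verit) mult_nonneg_nonpos)
    moreover have "A i j \<le> col_max h j" using fin i(1) by (simp add: col_max_def)
    ultimately have "A i j * z \<le> col_max h j * z" by (intro mult_right_mono) auto
    thus "col_max h j * z > t" using i(2) by simp
  next
    assume *: "col_max h j * z > t"
    have "col_max h j \<in> (\<lambda>i. A i j) ` h"
      unfolding col_max_def using fin assms(3) by (intro Max_in) auto
    thus "\<exists>i\<in>h. A i j * z > t" using * by auto
  qed
  have "max_over X h \<omega> > t \<longleftrightarrow> (\<exists>i\<in>h. X i \<omega> > t)"
    using fin assms(3) by (simp add: max_over_def Max_gr_iff)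
  also have "\<dots> \<longleftrightarrow> (\<exists>i\<in>h. \<exists>j\<in>{1..d}. A i j * Z j \<omega> > t)"
    using recursive_ML_gt_iff[OF assms(1,2) _ assms(5)] assms(4) by blast
  also have "\<dots> \<longleftrightarrow> (\<exists>j\<in>{1..d}. col_max h j * Z j \<omega> > t)"
    using col by blast
  finally show ?thesis .
qed

end

section \<open>Squared scalings\<close>

text \<open>By independence the probability is \<open>1 - (\<Prod>i\<in>I. 1 - p i n)\<close>. Each
  \<open>p i n\<close> is of order at most \<open>1 / n\<close>, so after multiplication by
  \<open>n\<close> only the terms linear in the \<open>p i n\<close> survive.\<close>

lemma (in prob_space) tendsto_scaled_prob_Union:
  fixes L :: "'i \<Rightarrow> real"
  assumes "indep_vars (\<lambda>_. borel) Z I" "finite I"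
    and "\<And>i n. i \<in> I \<Longrightarrow> B n i \<in> sets borel"
    and "\<And>i. i \<in> I \<Longrightarrow> (\<lambda>n. real n * prob (Z i -` B n i \<inter> space M)) \<longlonglongrightarrow> L i"
  shows "(\<lambda>n. real n * prob {\<omega>\<in>space M. \<exists>i\<in>I. Z i \<omega> \<in> B n i}) \<longlonglongrightarrow> sum L I"
proof -
  define p where "p i n = prob (Z i -` B n i \<inter> space M)" for i n
  have meas: "Z i -` S \<inter> space M \<in> events" if "i \<in> I" "S \<in> sets borel" for i S
    using assms(1) that unfolding indep_vars_def2 by (auto intro: measurable_sets)
  have p0: "p i \<longlonglongrightarrow> 0" if "i \<in> I" for i
  proof (rule Lim_transform_eventually)
    show "(\<lambda>n. (real n * p i n) * inverse (real n)) \<longlonglongrightarrow> 0"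
      using tendsto_mult[OF assms(4)[OF that] lim_inverse_n] by (simp add: p_def)
    show "\<forall>\<^sub>F n in sequentially. (real n * p i n) * inverse (real n) = p i n"
      using eventually_gt_at_top[of 0] by eventually_elim simp
  qed
  have prod: "prob {\<omega>\<in>space M. \<exists>i\<in>I. Z i \<omega> \<in> B n i} = 1 - (\<Prod>i\<in>I. 1 - p i n)" for n
  \<comment> \<open>The empty index set is treated apart, since an intersection over no sets need
    not lie inside \<open>space M\<close>.\<close>
  proof (cases "I = {}")
    case False
    have sets: "{\<omega>\<in>space M. \<exists>i\<in>I. Z i \<omega> \<in> B n i} \<in> events"
    proof -
      have "{\<omega>\<in>space M. \<exists>i\<in>I. Z i \<omega> \<in> B n i} = (\<Union>i\<in>I. Z i -` B n i \<inter> space M)" by auto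
      also have "\<dots> \<in> events" using meas assms(2,3) by (intro sets.finite_UN) auto
      finally show ?thesis .
    qed
    have "space M - {\<omega>\<in>space M. \<exists>i\<in>I. Z i \<omega> \<in> B n i} =
        (\<Inter>i\<in>I. Z i -` (- B n i) \<inter> space M)"
      using False by auto
    hence "1 - prob {\<omega>\<in>space M. \<exists>i\<in>I. Z i \<omega> \<in> B n i} =
        prob (\<Inter>i\<in>I. Z i -` (- B n i) \<inter> space M)"
      using prob_compl[OF sets] by simp
    also have "\<dots> = (\<Prod>i\<in>I. prob (Z i -` (- B n i) \<inter> space M))"
      using assms by (intro indep_varsD[OF assms(1)]) (auto simp: False borel_comp)
    also have "\<dots> = (\<Prod>i\<in>I. 1 - p i n)"
    proof (rule prod.cong)
      fix i assume i: "i \<in> I"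
      have "Z i -` (- B n i) \<inter> space M = space M - (Z i -` B n i \<inter> space M)" by auto
      thus "prob (Z i -` (- B n i) \<inter> space M) = 1 - p i n"
        using prob_compl[OF meas[OF i assms(3)[OF i]]] by (simp add: p_def)
    qed simp
    finally show ?thesis by simp
  qed simp
  \<comment> \<open>The induction step rests on
    \<open>1 - (1 - p) * P = (1 - P) * (1 - p) + p\<close>: the factor \<open>1 - p\<close> tends to
    1 by \<open>p0\<close>, so a new index adds just its own limit.\<close>
  have "(\<lambda>n. real n * (1 - (\<Prod>i\<in>J. 1 - p i n))) \<longlonglongrightarrow> sum L J" if "J \<subseteq> I" for J
    using finite_subset[OF that assms(2)] that
  proof (induction J rule: finite_induct)
    case (insert j J)
    have "(\<lambda>n. (real n * (1 - (\<Prod>i\<in>J. 1 - p i n))) * (1 - p j n) + real n * p j n)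
        \<longlonglongrightarrow> sum L J * (1 - 0) + L j"
      using insert assms(4)[of j] p0[of j] unfolding p_def by (intro tendsto_intros) auto
    also have "(\<lambda>n. (real n * (1 - (\<Prod>i\<in>J. 1 - p i n))) * (1 - p j n) + real n * p j n) =
        (\<lambda>n. real n * (1 - (\<Prod>i\<in>insert j J. 1 - p i n)))"
      using insert.hyps by (auto simp: algebra_simps)
    also have "sum L J * (1 - 0) + L j = sum L (insert j J)"
      using insert.hyps by simp
    finally show ?case .
  qed simp
  from this[of I] show ?thesis by (simp add: prod)
qed

text \<open>The threshold \<open>x = 1 / b\<close> in the margin condition gives the limit. For
  \<open>b = 0\<close> the event is empty, because \<open>sqrt (real n)\<close> is
  nonnegative.\<close>

lemma standardized_margins_scaled:
  assumes "standardized_margins M d Z" "j \<in> {1..d}" "b \<ge> 0"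
  shows "(\<lambda>n. real n * measure M {\<omega>\<in>space M. b * Z j \<omega> > sqrt (real n)}) \<longlonglongrightarrow> b\<^sup>2"
proof (cases "b = 0")
  case False
  hence b: "b > 0" using assms(3) by simp
  hence "(\<lambda>n. real n * measure M {\<omega>\<in>space M. Z j \<omega> / sqrt (real n) > 1 / b}) \<longlonglongrightarrow> 1 / (1 / b)\<^sup>2"
    using assms(1,2) unfolding standardized_margins_def by simp
  also have "(\<lambda>n. real n * measure M {\<omega>\<in>space M. Z j \<omega> / sqrt (real n) > 1 / b}) =
      (\<lambda>n. real n * measure M {\<omega>\<in>space M. b * Z j \<omega> > sqrt (real n)})"
  proof
    fix n :: nat
    show "real n * measure M {\<omega>\<in>space M. Z j \<omega> / sqrt (real n) > 1 / b} =
        real n * measure M {\<omega>\<in>space M. b * Z j \<omega> > sqrt (real n)}"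
    \<comment> \<open>At \<open>n = 0\<close> the two events may differ, as division by 0 yields 0,
      but the factor \<open>real n\<close> vanishes.\<close>
    proof (cases "n = 0")
      case False
      hence "Z j \<omega> / sqrt (real n) > 1 / b \<longleftrightarrow> b * Z j \<omega> > sqrt (real n)" for \<omega>
        using b by (simp add: field_simps)
      thus ?thesis by simp
    qed simp
  qed
  finally show ?thesis by (simp add: power_divide)
qed simp

lemma (in weighted_dag) scaling_seq_max_over:
  assumes "prob_space M" "innovations M d Z" "recursive_ML M d E c Z X"
    and "standardized_margins M d Z" "h \<noteq> {}" "h \<subseteq> {1..d}"
  shows "scaling_seq M (max_over X h) \<longlonglongrightarrow> (\<Sum>j=1..d. (col_max h j)\<^sup>2)"
proof -
  interpret prob_space M by fact
  have "(\<lambda>n. real n * prob {\<omega>\<in>space M. \<exists>j\<in>{1..d}. Z j \<omega> \<in> {z. col_max h j * z > sqrt (real n)}})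
      \<longlonglongrightarrow> (\<Sum>j=1..d. (col_max h j)\<^sup>2)"
  proof (rule tendsto_scaled_prob_Union)
    show "indep_vars (\<lambda>_. borel) Z {1..d}" using assms(2) by (simp add: innovations_def)
    fix j assume "j \<in> {1..d}"
    from standardized_margins_scaled[OF assms(4) this col_max_nonneg[OF assms(5,6)], of j]
    show "(\<lambda>n. real n * prob (Z j -` {z. col_max h j * z > sqrt (real n)} \<inter> space M))
        \<longlonglongrightarrow> (col_max h j)\<^sup>2"
      by (simp add: vimage_def Int_def conj_commute)
  qed auto
  also have "(\<lambda>n. real n * prob {\<omega>\<in>space M. \<exists>j\<in>{1..d}. Z j \<omega> \<in> {z. col_max h j * z > sqrt (real n)}}) =
      scaling_seq M (max_over X h)"
    unfolding scaling_seq_def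
    by (intro ext arg_cong2[of _ _ _ _ "(*)"] arg_cong[of _ _ prob] refl Collect_cong conj_cong)
      (simp add: max_over_gt_iff[OF assms(3) _ assms(5,6)])
  finally show ?thesis .
qed

text \<open>Beyond column \<open>j\<close> both column maxima are the diagonal entry. Up to column
  \<open>j\<close> the rows \<open>j+1..d\<close> vanish, which leaves row \<open>i\<close> alone,
  and its entries left of \<open>i\<close> vanish too. The condition \<open>j < d\<close> keeps the
  block of rows nonempty, so that \<open>Max\<close> is meaningful.\<close>

lemma (in weighted_dag) sum_col_max_insert:
  assumes "standardized_matrix d A" "1 \<le> i" "i \<le> j" "j < d"
  shows "(\<Sum>k=1..d. (col_max (insert i {j+1..d}) k)\<^sup>2) =
      (\<Sum>k=i..j. (A i k)\<^sup>2) + (\<Sum>k=1..d. (col_max {j+1..d} k)\<^sup>2)"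
proof -
  have split: "(\<Sum>k=1..d. f k) = (\<Sum>k=1..j. f k) + (\<Sum>k=j+1..d. f k)" for f :: "nat \<Rightarrow> real"
    using assms(4) sum.ub_add_nat[of 1 j f "d - j"] by simp
  have low: "col_max {j+1..d} k = 0" if "k \<le> j" for k
  proof -
    have "(\<lambda>i. A i k) ` {j+1..d} = {0}"
      using that assms(4) ml_coeff_upper by (auto simp: image_iff intro!: exI[of _ d])
    thus ?thesis by (simp add: col_max_def)
  qed
  have low': "col_max (insert i {j+1..d}) k = A i k" if "k \<le> j" for k
  proof -
    have "col_max (insert i {j+1..d}) k = max (A i k) (col_max {j+1..d} k)"
      unfolding col_max_def using assms(4) by simp
    thus ?thesis using low[OF that] ml_coeff_nonneg[of i k] assms by simp
  qed
  have "(\<Sum>k=1..d. (col_max (insert i {j+1..d}) k)\<^sup>2) =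
      (\<Sum>k=1..j. (A i k)\<^sup>2) + (\<Sum>k=j+1..d. (A k k)\<^sup>2)"
    unfolding split using low' assms
    by (intro arg_cong2[of _ _ _ _ "(+)"] sum.cong) (auto simp: col_max_diag)
  also have "(\<Sum>k=1..j. (A i k)\<^sup>2) = (\<Sum>k=i..j. (A i k)\<^sup>2)"
    using assms ml_coeff_upper by (intro sum.mono_neutral_right) auto
  also have "(\<Sum>k=j+1..d. (A k k)\<^sup>2) = (\<Sum>k=1..d. (col_max {j+1..d} k)\<^sup>2)"
    unfolding split using low assms by (simp add: col_max_diag)
  finally show ?thesis .
qed

text \<open>\<open>squared_scaling\<close> is built on the total operator \<open>lim\<close>.
  Convergence of the scaling sequences is therefore part of the claim: it makes every squared
  scaling in the recursion a genuine limit.\<close>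

theorem proposition2:
  fixes M :: "'a measure" and d :: nat and E :: "(nat \<times> nat) set"
    and c A :: "nat \<Rightarrow> nat \<Rightarrow> real" and Z X :: "nat \<Rightarrow> 'a \<Rightarrow> real"
    and \<sigma>M :: "nat set \<Rightarrow> real" and \<sigma>sq :: "nat \<Rightarrow> real"
  assumes "prob_space M" and "d \<ge> 1"
    and "well_ordered_dag d E" and "edge_weights d E c"
    and "innovations M d Z" and "recursive_ML M d E c Z X"
    and "RV_plus2 M d Z" and "standardized_margins M d Z"
    and "A = ml_coeff E c" and "standardized_matrix d A"
    and "\<And>h. \<sigma>M h = squared_scaling M (max_over X h)"
    and "\<And>i. \<sigma>sq i = squared_scaling M (X i)"
  shows "(\<forall>h. h \<noteq> {} \<and> h \<subseteq> {1..d} \<longrightarrow> convergent (scaling_seq M (max_over X h))) \<and>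
    ((A d d)\<^sup>2 = \<sigma>sq d \<and> \<sigma>sq d = 1) \<and>
    (\<forall>i\<in>{1..d-1}. (A i i)\<^sup>2 = \<sigma>M {i..d} - \<sigma>M {i+1..d}) \<and>
    (\<forall>i\<in>{1..d-2}. \<forall>j\<in>{i+1..d-1}.
       (A i j)\<^sup>2 = \<sigma>M (insert i {j+1..d}) - \<sigma>M {j+1..d} - (\<Sum>k=i..j-1. (A i k)\<^sup>2)) \<and>
    (\<forall>i\<in>{1..d-1}.
       (A i d)\<^sup>2 = \<sigma>sq i - (\<Sum>k=i..d-1. (A i k)\<^sup>2) \<and>
       \<sigma>sq i - (\<Sum>k=i..d-1. (A i k)\<^sup>2) = 1 - (\<Sum>k=i..d-1. (A i k)\<^sup>2))"
proof -
  interpret prob_space M by fact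
  interpret W: weighted_dag d E c by standard fact+
  note A = \<open>A = ml_coeff E c\<close>
  have std: "standardized_matrix d (ml_coeff E c)"
    using \<open>standardized_matrix d A\<close> A by simp
  have lim: "scaling_seq M (max_over X h) \<longlonglongrightarrow> (\<Sum>j=1..d. (W.col_max h j)\<^sup>2)"
    if "h \<noteq> {}" "h \<subseteq> {1..d}" for h
    by (rule W.scaling_seq_max_over) fact+
  have \<sigma>M: "\<sigma>M h = (\<Sum>j=1..d. (W.col_max h j)\<^sup>2)" if "h \<noteq> {}" "h \<subseteq> {1..d}" for h
    using limI[OF lim[OF that]] assms(11) by (simp add: squared_scaling_def)
  \<comment> \<open>One identity serves two formulas: \<open>j = i\<close> gives the diagonal, and
    \<open>i < j\<close> the further entries once the last summand is split off. Column
    \<open>d\<close> is left to \<open>row\<close>, as \<open>{d+1..d}\<close> is empty.\<close>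
  have diff: "\<sigma>M (insert i {j+1..d}) - \<sigma>M {j+1..d} = (\<Sum>k=i..j. (A i k)\<^sup>2)"
    if "1 \<le> i" "i \<le> j" "j < d" for i j
    using that by (subst (1 2) \<sigma>M) (auto simp: A W.sum_col_max_insert[OF std that, simplified])
  have row: "(\<Sum>k=i..d. (A i k)\<^sup>2) = 1" if "i \<in> {1..d}" for i
  proof -
    have "(\<Sum>k=i..d. (A i k)\<^sup>2) = (\<Sum>k=1..d. (A i k)\<^sup>2)"
      using that W.ml_coeff_upper by (intro sum.mono_neutral_left) (auto simp: A)
    thus ?thesis using std that by (simp add: standardized_matrix_def A)
  qed
  \<comment> \<open>For \<open>h = {i}\<close> the column maxima are row \<open>i\<close> itself,
    whose norm is 1.\<close>
  have \<sigma>sq: "\<sigma>sq i = 1" if "i \<in> {1..d}" for i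
  proof -
    have "\<sigma>sq i = \<sigma>M {i}"
      by (simp add: assms(11,12) max_over_def[abs_def])
    also have "\<dots> = (\<Sum>k=1..d. (A i k)\<^sup>2)"
      using that by (subst \<sigma>M) (auto simp: W.col_max_def A)
    finally show ?thesis using std that by (simp add: standardized_matrix_def A)
  qed
  have last: "(\<Sum>k=i..j. (A i k)\<^sup>2) = (\<Sum>k=i..j-1. (A i k)\<^sup>2) + (A i j)\<^sup>2" if "i < j" for i j
    using that by (cases j) auto
  show ?thesis
  proof (intro conjI allI ballI impI)
    fix h assume "h \<noteq> {} \<and> h \<subseteq> {1..d}"
    thus "convergent (scaling_seq M (max_over X h))" using lim by (auto simp: convergent_def)
  next
    show "\<sigma>sq d = 1" "(A d d)\<^sup>2 = \<sigma>sq d"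
      using \<sigma>sq[of d] row[of d] \<open>d \<ge> 1\<close> by auto
  next
    fix i assume i: "i \<in> {1..d-1}"
    have "insert i {i+1..d} = {i..d}" using i by auto
    thus "(A i i)\<^sup>2 = \<sigma>M {i..d} - \<sigma>M {i+1..d}" using diff[of i i] i by fastforce
  next
    fix i j assume "i \<in> {1..d-2}" "j \<in> {i+1..d-1}"
    thus "(A i j)\<^sup>2 = \<sigma>M (insert i {j+1..d}) - \<sigma>M {j+1..d} - (\<Sum>k=i..j-1. (A i k)\<^sup>2)"
      by (subst diff) (auto simp: last)
  next
    fix i assume i: "i \<in> {1..d-1}"
    hence "i \<in> {1..d}" "i < d" by auto
    thus "(A i d)\<^sup>2 = \<sigma>sq i - (\<Sum>k=i..d-1. (A i k)\<^sup>2)"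
      and "\<sigma>sq i - (\<Sum>k=i..d-1. (A i k)\<^sup>2) = 1 - (\<Sum>k=i..d-1. (A i k)\<^sup>2)"
      using row[of i] \<sigma>sq[of i] last[of i d] by auto
  qed
qed

end
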